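(* Let $U$ be an $n\times n$ matrix of the form $$U=\sum_{s=0}^k D_{C_s}F(\mathcal R_s)+D_{\Gamma_s}D_{p_s}F(\mathcal R_s)D_{q_s},$$ where $\mathcal R_0\prec\cdots\prec\mathcal R_k$ is a filtration of $\{1,\dots,n\}$ with $\mathcal R_0$ the trivial partition and $\mathcal R_k$ the partition into singletons, $C_s,\Gamma_s$ are nonnegative $\mathcal R_s$-measurable vectors, $\Gamma_k=0$, and for $s\le k-1$ $\{p_s,q_s\}$ is an $\mathcal R_{s+1}$-measurable partition. Let $\mathbb E_s$, $c_s$, $\gamma_s$, $\rho_s$ be as defined in the context. Assume that for $s=k-1,\dots,0$ $$\rho_s\gamma_s\le c_{s+1}+\gamma_{s+1}.$$ Then the backward recursion, for $s=k-1,\dots,0$, $$\frac1{d_s}=\mathbb E_s\!\left(\frac1{c_{s+1}+d_{s+1}}\right)-\gamma_s\,\mathbb E_s\!\left(\frac{p_s}{c_{s+1}+d_{s+1}}\right)\mathbb E_s\!\left(\frac{q_s}{c_{s+1}+d_{s+1}}\right),\qquad d_k=\mathbf 1,$$ has a nonnegative solution, and it satisfies $\rho_s\gamma_s\le c_{s+1}+d_{s+1}$ for $s=k-1,\dots,0$. In particular, $\mathbb I+tU$ is a bi-potential for all $t\ge 0$, and $U$ is a bi-potential if it is nonsingular.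
   Context: A partition $\mathcal R$ of $\{1,\dots,n\}$ has atoms (its blocks); $\mathcal R\prec\mathcal Q$ means $\mathcal R\ne\mathcal Q$ and every atom of $\mathcal Q$ is contained in an atom of $\mathcal R$. A filtration is a strictly increasing sequence $\mathcal R_0\prec\cdots\prec\mathcal R_k$. $F(\mathcal R)$ is the $0/1$ matrix with $F(\mathcal R)_{ij}=1$ iff $i,j$ are in the same atom of $\mathcal R$. A vector is $\mathcal R$-measurable if it is constant on atoms of $\mathcal R$. $\{p_s,q_s\}$ is an $\mathcal R_{s+1}$-measurable partition if $p_s,q_s$ are $\{0,1\}$-valued $\mathcal R_{s+1}$-measurable vectors with $p_s\odot q_s=0$ and $p_s+q_s=\mathbf 1$. $D_v$ is the diagonal matrix with diagonal $v$; $\odot$ is the entrywise product; $\mathbb I$ is the identity matrix; $\mathbf 1$ is the vector of ones. Since $\Gamma_k=0$, the term with $p_k,q_k$ is absent. $\mathbb E_s=D_{F(\mathcal R_s)\mathbf 1}^{-1}F(\mathcal R_s)$ is the conditional expectation (averaging over atoms) for $\mathcal R_s$, and $\mathbb E_s(v)$ is the vector obtained by applying it to $v$; $c_s=C_s\odot F(\mathcal R_s)\mathbf 1$, $\gamma_s=\Gamma_s\odot F(\mathcal R_s)\mathbf 1$; $\rho_s=\mathbb E_s(p_s)p_s+\mathbb E_s(q_s)q_s$. Products, quotients and inequalities of vectors are componentwise. Components of $d_s$ may a priori take the value $\infty$ ($1/\infty=0$). A nonnegative matrix $V$ is a bi-potential if it is nonsingular and $(V^{-1})_{ij}\le 0$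 for $i\neq j$, $(V^{-1})_{ii}>0$, $\sum_j (V^{-1})_{ij}\ge 0$ for every $i$, and $\sum_i (V^{-1})_{ij}\ge 0$ for every $j$. *)

theory Defs
  imports "HOL-Analysis.Analysis" "HOL-Library.Disjoint_Sets" "HOL-Library.Extended_Real"
begin

text \<open>
  The index set \<open>{1,\<dots>,n}\<close> is the finite type \<^typ>\<open>'n\<close>; partitions are sets of blocks.
  On vectors, \<open>+\<close>, \<open>-\<close>, \<open>*\<close>, \<open>1\<close> and \<open>\<le>\<close> are the componentwise library operations, so that
  \<open>*\<close> is the entrywise product and \<open>1\<close> the vector of ones.
\<close>

definition coarser :: "'n set set \<Rightarrow> 'n set set \<Rightarrow> bool" where
  "coarser R Q \<longleftrightarrow> R \<noteq> Q \<and> refines UNIV Q R"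

definition filtration :: "nat \<Rightarrow> (nat \<Rightarrow> 'n set set) \<Rightarrow> bool" where
  "filtration k R \<longleftrightarrow> (\<forall>s\<le>k. partition_on UNIV (R s)) \<and> (\<forall>s<k. coarser (R s) (R (Suc s)))"

definition trivial_partition :: "'n set set" where
  "trivial_partition = {UNIV}"

definition singleton_partition :: "'n set set" where
  "singleton_partition = range (\<lambda>i. {i})"

definition measurable_vec :: "'n set set \<Rightarrow> real^'n \<Rightarrow> bool" where
  "measurable_vec R v \<longleftrightarrow> (\<forall>A\<in>R. \<forall>i\<in>A. \<forall>j\<in>A. v $ i = v $ j)"

definition measurable_partition :: "'n set set \<Rightarrow> real^'n \<Rightarrow> real^'n \<Rightarrow> bool" where
  "measurable_partition R p q \<longleftrightarrow>
     (\<forall>i. p $ i \<in> {0, 1}) \<and> (\<forall>i. q $ i \<in> {0, 1}) \<and>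
     measurable_vec R p \<and> measurable_vec R q \<and> p * q = 0 \<and> p + q = 1"

definition F :: "'n set set \<Rightarrow> real^'n^'n" where
  "F R = (\<chi> i j. if \<exists>A\<in>R. i \<in> A \<and> j \<in> A then 1 else 0)"

definition diag :: "real^'n \<Rightarrow> real^'n^'n" where
  "diag v = (\<chi> i j. if i = j then v $ i else 0)"

definition cond_exp :: "'n::finite set set \<Rightarrow> real^'n^'n" where
  "cond_exp R = matrix_inv (diag (F R *v 1)) ** F R"

definition rho :: "'n::finite set set \<Rightarrow> real^'n \<Rightarrow> real^'n \<Rightarrow> real^'n" where
  "rho R p q = (cond_exp R *v p) * p + (cond_exp R *v q) * q"

text \<open>
  The vectors \<open>d\<^sub>s\<close> may take the value \<open>\<infinity>\<close>, hence the extended real versions of \<open>\<^bold>E\<^sub>s(v)\<close> and of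
  the componentwise quotient. The operator \<open>*v\<close> is not available there, since the extended
  reals do not form a semiring. In \<^typ>\<open>ereal\<close>, \<open>1 / \<infinity> = 0\<close>.
\<close>

definition ereal_vec :: "real^'n \<Rightarrow> ereal^'n" where
  "ereal_vec v = (\<chi> i. ereal (v $ i))"

definition cond_exp_ereal :: "'n::finite set set \<Rightarrow> ereal^'n \<Rightarrow> ereal^'n" where
  "cond_exp_ereal R v = (\<chi> i. \<Sum>j\<in>UNIV. ereal (cond_exp R $ i $ j) * v $ j)"

definition quot :: "ereal^'n \<Rightarrow> ereal^'n \<Rightarrow> ereal^'n" where
  "quot u v = (\<chi> i. u $ i / v $ i)"

text \<open>
  \<open>d\<^sub>0,\<dots>,d\<^sub>k\<close> solve the backward recursion; entries with index above \<open>k\<close> are irrelevant.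
  As \<open>d\<^sub>k = \<^bold>1\<close>, no denominator \<open>c\<^sub>s\<^sub>+\<^sub>1 + d\<^sub>s\<^sub>+\<^sub>1\<close> of a nonnegative solution vanishes when
  \<open>c \<ge> 0\<close>: where \<open>d\<^sub>s\<^sub>+\<^sub>1\<close> was \<open>0\<close>, \<open>1 / d\<^sub>s\<^sub>+\<^sub>1\<close> would be \<open>\<infinity>\<close>, but the right-hand side
  is finite.
\<close>

definition backward_recursion ::
  "nat \<Rightarrow> (nat \<Rightarrow> 'n::finite set set) \<Rightarrow> (nat \<Rightarrow> real^'n) \<Rightarrow> (nat \<Rightarrow> real^'n) \<Rightarrow>
   (nat \<Rightarrow> real^'n) \<Rightarrow> (nat \<Rightarrow> real^'n) \<Rightarrow> (nat \<Rightarrow> ereal^'n) \<Rightarrow> bool" where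
  "backward_recursion k R c \<gamma> p q d \<longleftrightarrow>
     d k = 1 \<and>
     (\<forall>s<k.
        quot 1 (d s) =
          cond_exp_ereal (R s) (quot 1 (ereal_vec (c (Suc s)) + d (Suc s)))
          - ereal_vec (\<gamma> s)
            * cond_exp_ereal (R s) (quot (ereal_vec (p s)) (ereal_vec (c (Suc s)) + d (Suc s)))
            * cond_exp_ereal (R s) (quot (ereal_vec (q s)) (ereal_vec (c (Suc s)) + d (Suc s))))"

definition bi_potential :: "real^'n^'n \<Rightarrow> bool" where
  "bi_potential V \<longleftrightarrow>
     (\<forall>i j. 0 \<le> V $ i $ j) \<and>
     invertible V \<and>
     (\<forall>i j. i \<noteq> j \<longrightarrow> matrix_inv V $ i $ j \<le> 0) \<and>
     (\<forall>i. 0 < matrix_inv V $ i $ i) \<and>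
     (\<forall>i. 0 \<le> (\<Sum>j\<in>UNIV. matrix_inv V $ i $ j)) \<and>
     (\<forall>j. 0 \<le> (\<Sum>i\<in>UNIV. matrix_inv V $ i $ j))"

end

theory Submission
  imports Defs
begin

text \<open>
  Write \<open>V\<^sub>s\<close> for \<open>\<^bold>I\<close> plus the terms of \<open>U\<close> of index at least \<open>s\<close>. It is block diagonal with
  respect to \<open>R\<^sub>s\<close>, and \<open>V\<^sub>s\<close> arises from \<open>V\<^sub>s\<^sub>+\<^sub>1\<close> by two successive rank one updates of each
  block. The Sherman--Morrison formula gives the inverses explicitly; their off-diagonal entries
  only decrease, and the average of the row sums of \<open>V\<^sub>s\<^sup>-\<^sup>1\<close> over an atom of \<open>R\<^sub>s\<close> is
  \<open>1 / (c\<^sub>s + d\<^sub>s)\<close>, which is where the backward recursion comes from. The row and column sums stay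
  nonnegative as long as \<open>\<gamma>\<^sub>s \<^bold>E\<^sub>s(p\<^sub>s / (c\<^sub>s\<^sub>+\<^sub>1 + d\<^sub>s\<^sub>+\<^sub>1)) \<le> 1\<close>, and likewise for \<open>q\<^sub>s\<close>, and this
  follows from \<open>\<rho>\<^sub>s \<gamma>\<^sub>s \<le> c\<^sub>s\<^sub>+\<^sub>1 + d\<^sub>s\<^sub>+\<^sub>1\<close>. That bound in turn is inherited from the hypothesis because
  \<open>\<gamma>\<^sub>s \<le> d\<^sub>s\<close> for all \<open>s\<close>. The hypothesis is invariant under scaling \<open>U\<close> by \<open>t\<close>, and \<open>U\<close> itself is
  the limit of \<open>(\<^bold>I + t U) / t\<close> as \<open>t\<close> tends to infinity.
\<close>

subsection \<open>Inverses and bi-potentials\<close>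

lemma matrix_inv_eqI:
  fixes A B :: "real^'n^'n"
  assumes "A ** B = mat 1"
  shows "matrix_inv A = B"
  unfolding matrix_inv_def
proof (rule some_equality)
  show "A ** B = mat 1 \<and> B ** A = mat 1"
    using assms matrix_left_right_inverse by blast
next
  fix A' assume "A ** A' = mat 1 \<and> A' ** A = mat 1"
  then show "A' = B"
    using assms by (metis matrix_mul_assoc matrix_mul_lid matrix_mul_rid)
qed

text \<open>Strict positivity of the diagonal is automatic: if \<open>M $ i $ i\<close> were
  nonpositive, the whole row \<open>i\<close> of \<open>M\<close> would be nonpositive with
  nonnegative sum, hence zero, contradicting \<open>M ** V = mat 1\<close>.\<close>

lemma bi_potentialI:
  fixes V M :: "real^'n^'n"
  assumes "\<And>i j. 0 \<le> V $ i $ j" and inv: "V ** M = mat 1"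
    and off: "\<And>i j. i \<noteq> j \<Longrightarrow> M $ i $ j \<le> 0"
    and row: "\<And>i. 0 \<le> (\<Sum>j\<in>UNIV. M $ i $ j)" and col: "\<And>j. 0 \<le> (\<Sum>i\<in>UNIV. M $ i $ j)"
  shows "bi_potential V"
proof -
  have "0 < M $ i $ i" for i
  proof (rule ccontr)
    assume "\<not> 0 < M $ i $ i"
    then have nonpos: "M $ i $ j \<le> 0" for j using off by (cases "i = j") auto
    then have "(\<Sum>j\<in>UNIV. - M $ i $ j) = 0"
      using row[of i] sum_nonpos[of UNIV "\<lambda>j. M $ i $ j"] by (simp add: sum_negf)
    then have "M $ i $ j = 0" for j
      using nonpos by (subst (asm) sum_nonneg_eq_0_iff) auto
    then have "(M ** V) $ i $ i = 0" by (simp add: matrix_matrix_mult_def)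
    moreover have "M ** V = mat 1" using inv matrix_left_right_inverse by blast
    ultimately show False by (simp add: mat_def)
  qed
  moreover have "invertible V" using inv invertible_right_inverse by blast
  ultimately show ?thesis
    using assms by (simp add: bi_potential_def matrix_inv_eqI[OF inv])
qed

section \<open>Continuity of the matrix inverse and limits of bi-potentials\<close>

lemma matrix_inv_right:
  fixes V :: "real^'n^'n"
  shows "invertible V \<Longrightarrow> V ** matrix_inv V = mat 1"
  using matrix_inv_eqI unfolding invertible_def by metis

lemma tendsto_det:
  fixes f :: "'a \<Rightarrow> real^'n^'n"
  assumes "\<And>i j. ((\<lambda>x. f x $ i $ j) \<longlongrightarrow> A $ i $ j) X"
  shows "((\<lambda>x. det (f x)) \<longlongrightarrow> det A) X"
  unfolding det_def by (intro tendsto_sum tendsto_mult tendsto_const tendsto_prod assms)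

text \<open>Cramer's rule: it writes the entries of the inverse as quotients of determinants, which
  makes them continuous in the entries of an invertible matrix.\<close>

lemma matrix_inv_nth:
  fixes A :: "real^'n^'n"
  assumes "invertible A"
  shows "matrix_inv A $ i $ j = det (\<chi> a b. if b = i then axis j 1 $ a else A $ a $ b) / det A"
proof -
  have "A *v (matrix_inv A *v axis j 1) = axis j 1"
    by (simp add: matrix_vector_mul_assoc matrix_inv_right[OF assms])
  moreover have "det A \<noteq> 0" using assms invertible_det_nz by blast
  ultimately have "matrix_inv A *v axis j 1
      = (\<chi> k. det (\<chi> a b. if b = k then axis j 1 $ a else A $ a $ b) / det A)"
    using cramer by blast
  moreover have "(matrix_inv A *v axis j 1) $ i = matrix_inv A $ i $ j"
    by (simp add: matrix_vector_mult_basis column_def)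
  ultimately show ?thesis by simp
qed

lemma tendsto_matrix_inv:
  fixes f :: "'a \<Rightarrow> real^'n^'n"
  assumes f: "(f \<longlongrightarrow> A) X" and A: "invertible A" and inv: "\<forall>\<^sub>F x in X. invertible (f x)"
  shows "((\<lambda>x. matrix_inv (f x) $ i $ j) \<longlongrightarrow> matrix_inv A $ i $ j) X"
proof -
  have *: "((\<lambda>x. f x $ a $ b) \<longlongrightarrow> A $ a $ b) X" for a b
    by (intro tendsto_vec_nth f)
  have "((\<lambda>x. det (\<chi> a b. if b = i then axis j 1 $ a else f x $ a $ b) / det (f x))
      \<longlongrightarrow> matrix_inv A $ i $ j) X"
    unfolding matrix_inv_nth[OF A] using A invertible_det_nz *
    by (intro tendsto_divide tendsto_det) auto
  then show ?thesis
    by (rule Lim_transform_eventually) (use inv in eventually_elim, simp add: matrix_inv_nth)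
qed

text \<open>The conditions that \<open>bi_potentialI\<close> asks for are weak inequalities and
  survive the limit; the strict positivity of the diagonal is recovered there.\<close>

lemma bi_potential_limit:
  fixes f :: "nat \<Rightarrow> real^'n^'n"
  assumes f: "f \<longlonglongrightarrow> V" and V: "invertible V" and bi: "\<And>n. bi_potential (f n)"
  shows "bi_potential V"
proof (rule bi_potentialI)
  have inv: "(\<lambda>n. matrix_inv (f n) $ i $ j) \<longlonglongrightarrow> matrix_inv V $ i $ j" for i j
    using bi by (intro tendsto_matrix_inv f V) (simp add: bi_potential_def)
  show "0 \<le> V $ i $ j" for i j
    using bi by (intro tendsto_lowerbound[OF tendsto_vec_nth[OF tendsto_vec_nth[OF f]]])
      (auto simp: bi_potential_def)
  show "V ** matrix_inv V = mat 1" by (rule matrix_inv_right[OF V])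
  show "matrix_inv V $ i $ j \<le> 0" if "i \<noteq> j" for i j
    using bi that by (intro tendsto_upperbound[OF inv]) (auto simp: bi_potential_def)
  show "0 \<le> (\<Sum>j\<in>UNIV. matrix_inv V $ i $ j)" for i
    using bi by (intro tendsto_lowerbound[OF tendsto_sum[OF inv]]) (auto simp: bi_potential_def)
  show "0 \<le> (\<Sum>i\<in>UNIV. matrix_inv V $ i $ j)" for j
    using bi by (intro tendsto_lowerbound[OF tendsto_sum[OF inv]]) (auto simp: bi_potential_def)
qed

lemma bi_potential_scaleR:
  fixes V :: "real^'n^'n"
  assumes "0 < a" "bi_potential V"
  shows "bi_potential (a *\<^sub>R V)"
proof (rule bi_potentialI)
  have "(a *\<^sub>R V) ** (inverse a *\<^sub>R matrix_inv V) = V ** matrix_inv V"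
    using assms(1) by (simp add: matrix_matrix_mult_def vec_eq_iff field_simps)
  also have "\<dots> = mat 1"
    using assms(2) by (intro matrix_inv_right) (simp add: bi_potential_def)
  finally show "(a *\<^sub>R V) ** (inverse a *\<^sub>R matrix_inv V) = mat 1" .
qed (use assms in \<open>auto simp: bi_potential_def mult_nonneg_nonpos simp flip: sum_distrib_left\<close>)

subsection \<open>Block diagonal matrices\<close>

definition block_diagonal :: "'n set set \<Rightarrow> real^'n^'n \<Rightarrow> bool" where
  "block_diagonal R M \<longleftrightarrow> (\<forall>i j. F R $ i $ j = 0 \<longrightarrow> M $ i $ j = 0)"

lemma F_trans:
  assumes "partition_on UNIV R" "F R $ i $ l \<noteq> 0"
  shows "F R $ l $ j = F R $ i $ j"
proof -
  obtain A where A: "A \<in> R" "i \<in> A" "l \<in> A"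
    using assms(2) by (auto simp: F_def split: if_splits)
  have "B = A" if "B \<in> R" "x \<in> A" "x \<in> B" for B x
    using partition_onD2[OF assms(1)] A that by (auto dest: disjointD)
  then have "(\<exists>B\<in>R. l \<in> B \<and> j \<in> B) \<longleftrightarrow> (\<exists>B\<in>R. i \<in> B \<and> j \<in> B)"
    using A by metis
  then show ?thesis by (simp add: F_def)
qed

lemma block_diagonal_mult_F:
  assumes "partition_on UNIV R" "block_diagonal R M"
  shows "M $ i $ l * F R $ l $ j = M $ i $ l * F R $ i $ j"
  using assms(2) F_trans[OF assms(1), of i l j]
  unfolding block_diagonal_def by (cases "M $ i $ l = 0") auto

lemma F_refl [simp]: "partition_on UNIV R \<Longrightarrow> F R $ i $ i = 1"
  unfolding F_def partition_on_def by auto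

lemma F_commute: "F R $ i $ j = F R $ j $ i"
  unfolding F_def by (auto)

lemma F_nonneg [simp]: "0 \<le> F R $ i $ j"
  unfolding F_def by auto

text \<open>A nonzero entry \<open>M $ i $ j\<close> forces \<open>i\<close> and \<open>j\<close>
  into one atom, where \<open>v\<close> is constant. Measurable vectors thus act as scalars on each
  block, and factor out of products with \<open>M\<close> on either side.\<close>

lemma block_diagonal_measurable:
  assumes "block_diagonal R M" "measurable_vec R v"
  shows "M $ i $ j * v $ j = M $ i $ j * v $ i"
  using assms unfolding block_diagonal_def measurable_vec_def F_def
  by (cases "M $ i $ j = 0") (force split: if_splits)+

lemma block_diagonal_F: "block_diagonal R (F R)"
  unfolding block_diagonal_def by simp

lemma measurable_vec_iff_F: "measurable_vec R v \<longleftrightarrow> (\<forall>i j. F R $ i $ j \<noteq> 0 \<longrightarrow> v $ i = v $ j)"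
  unfolding measurable_vec_def F_def by (auto split: if_splits)

lemma F_mono_refines:
  assumes "refines UNIV Q R" "F R $ i $ j = 0"
  shows "F Q $ i $ j = 0"
proof -
  have "\<not> (\<exists>A\<in>R. i \<in> A \<and> j \<in> A)"
    using assms(2) by (simp add: F_def split: if_splits)
  moreover have "\<exists>B\<in>R. A \<subseteq> B" if "A \<in> Q" for A
    using assms(1) that by (auto simp: refines_def)
  ultimately have "\<not> (\<exists>A\<in>Q. i \<in> A \<and> j \<in> A)"
    by (meson subsetD)
  then show ?thesis by (simp add: F_def)
qed

lemma block_diagonal_refines: "refines UNIV Q R \<Longrightarrow> block_diagonal Q M \<Longrightarrow> block_diagonal R M"
  unfolding block_diagonal_def using F_mono_refines by blast

lemma measurable_vec_mult: "measurable_vec R u \<Longrightarrow> measurable_vec R v \<Longrightarrow> measurable_vec R (u * v)"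
  unfolding measurable_vec_iff_F by simp

lemma measurable_vec_scaleR: "measurable_vec R v \<Longrightarrow> measurable_vec R (a *\<^sub>R v)"
  unfolding measurable_vec_iff_F by simp

lemma block_diagonal_add: "block_diagonal R M \<Longrightarrow> block_diagonal R N \<Longrightarrow> block_diagonal R (M + N)"
  and block_diagonal_diff: "block_diagonal R M \<Longrightarrow> block_diagonal R N \<Longrightarrow> block_diagonal R (M - N)"
  unfolding block_diagonal_def by auto

lemma block_diagonal_mult_measurable:
  assumes "block_diagonal R M" "measurable_vec R a"
  shows "M *v (a * v) = a * (M *v v)"
proof -
  have "M $ i $ j * (a $ j * v $ j) = a $ i * (M $ i $ j * v $ j)" for i j
    using block_diagonal_measurable[OF assms, of i j] by auto
  then show ?thesis
    by (simp only: vec_eq_iff matrix_vector_mult_def vec_lambda_beta vector_mult_component sum_distrib_left simp_thms)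
qed

lemma block_diagonal_measurable_mult:
  assumes "block_diagonal R M" "measurable_vec R a"
  shows "(a * v) v* M = a * (v v* M)"
proof -
  have "a $ i * v $ i * M $ i $ j = a $ j * (v $ i * M $ i $ j)" for i j
    using block_diagonal_measurable[OF assms, of i j] by auto
  then show ?thesis
    by (simp only: vec_eq_iff vector_matrix_mult_def vec_lambda_beta vector_mult_component sum_distrib_left simp_thms)
qed

section \<open>Blockwise rank one matrices\<close>

lemma matrix_mult_distrib:
  fixes A B :: "real^'n^'m" and D E :: "real^'p^'n"
  shows "(A + B) ** D = A ** D + B ** D" and "A ** (D - E) = A ** D - A ** E"
  by (simp_all add: vec_eq_iff matrix_matrix_mult_def algebra_simps sum.distrib sum_subtractf)

text \<open>On the block of each atom this is the rank one matrix with column \<open>a\<close> and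
  row \<open>b\<close>; it vanishes elsewhere. Both kinds of summand of \<open>U\<close> have this
  form.\<close>

definition block_outer :: "'n set set \<Rightarrow> real^'n \<Rightarrow> real^'n \<Rightarrow> real^'n^'n" where
  "block_outer R a b = (\<chi> i j. a $ i * F R $ i $ j * b $ j)"

lemma block_outer_nth: "block_outer R a b $ i $ j = a $ i * F R $ i $ j * b $ j"
  by (simp add: block_outer_def)

lemma block_diagonal_block_outer: "block_diagonal R (block_outer R a b)"
  by (simp add: block_diagonal_def block_outer_nth)

text \<open>Where \<open>M $ i $ l\<close> is nonzero, \<open>F R $ l $ j\<close> equals
  \<open>F R $ i $ j\<close> and leaves the sum over \<open>l\<close>.\<close>

lemma block_diagonal_times_block_outer:
  assumes "partition_on UNIV R" "block_diagonal R M"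
  shows "M ** block_outer R a b = block_outer R (M *v a) b"
proof -
  have "M $ i $ l * (a $ l * F R $ l $ j * b $ j) = M $ i $ l * a $ l * F R $ i $ j * b $ j" for i j l
    using block_diagonal_mult_F[OF assms, of i l j] by auto
  then show ?thesis
    by (simp only: vec_eq_iff matrix_matrix_mult_def matrix_vector_mult_def block_outer_nth
        vec_lambda_beta sum_distrib_right simp_thms)
qed

lemma block_outer_times_block_diagonal:
  assumes "partition_on UNIV R" "block_diagonal R M"
  shows "block_outer R a b ** M = block_outer R a (b v* M)"
proof -
  have "F R $ i $ l * M $ l $ j = F R $ i $ j * M $ l $ j" for i j l
  proof -
    have "M $ l $ j * F R $ j $ i = M $ l $ j * F R $ l $ i"
      by (rule block_diagonal_mult_F[OF assms])
    then show ?thesis by (auto simp: F_commute[of R _ i])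
  qed
  then have "a $ i * F R $ i $ l * b $ l * M $ l $ j = a $ i * F R $ i $ j * (b $ l * M $ l $ j)" for i j l
    by (simp add: mult_ac)
  then show ?thesis
    by (simp only: vec_eq_iff matrix_matrix_mult_def vector_matrix_mult_def block_outer_nth
        vec_lambda_beta sum_distrib_left simp_thms)
qed

lemma block_outer_mult_vec: "block_outer R a b *v v = a * (F R *v (b * v))"
  by (simp add: vec_eq_iff matrix_vector_mult_def block_outer_nth sum_distrib_left mult_ac)

lemma vec_mult_block_outer: "v v* block_outer R a b = b * (F R *v (a * v))"
  by (simp add: vec_eq_iff matrix_vector_mult_def vector_matrix_mult_def block_outer_nth sum_distrib_left F_commute mult_ac)

lemma block_outer_diff_left: "block_outer R (a - a') b = block_outer R a b - block_outer R a' b"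
  by (simp add: vec_eq_iff block_outer_nth algebra_simps)

lemma diag_nth: "diag v $ i $ j = (if i = j then v $ i else 0)"
  by (simp add: diag_def)

lemma diag_mult_nth: "(diag v ** M) $ i $ j = v $ i * M $ i $ j"
  by (simp add: matrix_matrix_mult_def diag_nth if_distrib[where f = "\<lambda>x. x * _"] cong: if_cong)

lemma mult_diag_nth: "(M ** diag v) $ i $ j = M $ i $ j * v $ j"
  by (simp add: matrix_matrix_mult_def diag_nth if_distrib[where f = "\<lambda>x. _ * x"] cong: if_cong)

lemma diag_F_diag_eq_block_outer:
  "diag a ** diag u ** F R ** diag v = block_outer R (a * u) v"
  by (simp add: vec_eq_iff mult_diag_nth diag_mult_nth block_outer_nth matrix_mul_assoc[symmetric])

lemma diag_F_eq_block_outer: "diag a ** F R = block_outer R a 1"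
  by (simp add: vec_eq_iff diag_mult_nth block_outer_nth)

text \<open>Sherman--Morrison, simultaneously on all blocks.\<close>

lemma block_outer_update_inverse:
  assumes R: "partition_on UNIV R" and V: "block_diagonal R V" and M: "block_diagonal R M"
    and inv: "V ** M = mat 1" and b: "measurable_vec R b"
    and eq: "b + b * a * (F R *v (v * (M *v u))) = a"
  shows "(V + block_outer R (a * u) v) ** (M - block_outer R (b * (M *v u)) (v v* M)) = mat 1"
proof -
  \<comment> \<open>\<open>F R *v (v * (M *v u))\<close> is the blockwise scalar product of
    \<open>v\<close> with \<open>M *v u\<close>, so \<open>eq\<close> says that \<open>b\<close> is
    the Sherman--Morrison coefficient, written without division. Being measurable, \<open>b\<close>
    passes through \<open>V\<close> and \<open>F R\<close>.\<close>
  have "V *v (b * (M *v u)) = b * u"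
    using block_diagonal_mult_measurable[OF V b] inv by (simp add: matrix_vector_mul_assoc)
  moreover have "F R *v (v * (b * (M *v u))) = b * (F R *v (v * (M *v u)))"
    using block_diagonal_mult_measurable[OF block_diagonal_F b] by (metis mult.left_commute)
  then have "block_outer R (a * u) v ** block_outer R (b * (M *v u)) (v v* M)
      = block_outer R (a * u * (b * (F R *v (v * (M *v u))))) (v v* M)"
    using block_diagonal_times_block_outer[OF R block_diagonal_block_outer]
    by (simp add: block_outer_mult_vec)
  \<comment> \<open>By \<open>eq\<close>, the left factors of the three outer products with
    \<open>v v* M\<close> in the expanded product cancel.\<close>
  moreover have "a * u * (b * (F R *v (v * (M *v u)))) = a * u - b * u"
    using eq by (metis (no_types, lifting) add_diff_cancel_left' left_diff_distrib mult.commute mult.assoc)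
  ultimately show ?thesis
    by (simp add: matrix_mult_distrib inv
        block_diagonal_times_block_outer[OF R V] block_outer_times_block_diagonal[OF R M]
        block_outer_diff_left)
qed

subsection \<open>Conditional expectations\<close>

lemma F_mult_one_pos:
  assumes "partition_on UNIV R"
  shows "0 < (F R *v 1) $ i"
proof -
  have "1 \<le> (\<Sum>j\<in>UNIV. F R $ i $ j)"
    using member_le_sum[of i UNIV "\<lambda>j. F R $ i $ j"] assms by simp
  then show ?thesis by (simp add: matrix_vector_mult_def)
qed

lemma cond_exp_nth:
  assumes "partition_on UNIV R"
  shows "cond_exp R $ i $ j = F R $ i $ j / (F R *v 1) $ i"
proof -
  have "diag (F R *v 1) ** diag (\<chi> i. 1 / (F R *v 1) $ i) = mat 1"
    using F_mult_one_pos[OF assms] by (simp add: vec_eq_iff diag_mult_nth diag_nth mat_def less_imp_neq[symmetric])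
  then show ?thesis
    by (simp add: cond_exp_def matrix_inv_eqI diag_mult_nth)
qed

lemma cond_exp_mult_vec_nth:
  assumes "partition_on UNIV R"
  shows "(cond_exp R *v v) $ i = (F R *v v) $ i / (F R *v 1) $ i"
  by (simp add: matrix_vector_mult_def cond_exp_nth[OF assms] sum_divide_distrib)

text \<open>Sums over atoms are averages times atom sizes; this is how \<open>C\<close> and
  \<open>G\<close> turn into \<open>c\<close> and \<open>g\<close>.\<close>

lemma F_mult_vec:
  assumes "partition_on UNIV R"
  shows "F R *v v = (F R *v 1) * (cond_exp R *v v)"
  using F_mult_one_pos[OF assms]
  by (simp add: vec_eq_iff cond_exp_mult_vec_nth[OF assms] less_imp_neq[symmetric])

lemma measurable_F_mult:
  assumes "partition_on UNIV R"
  shows "measurable_vec R (F R *v v)"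
  using F_trans[OF assms] by (simp add: measurable_vec_iff_F matrix_vector_mult_def)

lemma measurable_cond_exp:
  assumes "partition_on UNIV R"
  shows "measurable_vec R (cond_exp R *v v)"
  using measurable_F_mult[OF assms]
  by (simp add: measurable_vec_iff_F cond_exp_mult_vec_nth[OF assms])

lemma block_diagonal_cond_exp:
  assumes "partition_on UNIV R"
  shows "block_diagonal R (cond_exp R)"
  by (simp add: block_diagonal_def cond_exp_nth[OF assms])

lemma cond_exp_one:
  assumes "partition_on UNIV R"
  shows "cond_exp R *v 1 = 1"
  using F_mult_one_pos[OF assms]
  by (simp add: vec_eq_iff cond_exp_mult_vec_nth[OF assms] less_imp_neq[symmetric])

text \<open>Inside an atom all entries are the inverse of its size, which both indices
  share.\<close>

lemma transpose_cond_exp: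
  assumes "partition_on UNIV R"
  shows "transpose (cond_exp R) = cond_exp R"
proof -
  have "cond_exp R $ j $ i = cond_exp R $ i $ j" for i j
    using measurable_F_mult[OF assms, of 1]
    by (cases "F R $ i $ j = 0") (auto simp: cond_exp_nth[OF assms] measurable_vec_iff_F F_commute[of R j i])
  then show ?thesis by (simp add: transpose_def vec_eq_iff)
qed

lemma cond_exp_measurable_mult:
  assumes "partition_on UNIV R" "measurable_vec R a"
  shows "cond_exp R *v (a * v) = a * (cond_exp R *v v)"
  by (rule block_diagonal_mult_measurable[OF block_diagonal_cond_exp[OF assms(1)] assms(2)])

lemma cond_exp_nonneg:
  assumes "partition_on UNIV R" "\<And>i. 0 \<le> v $ i"
  shows "0 \<le> (cond_exp R *v v) $ i"
  using F_mult_one_pos[OF assms(1)] assms(2)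
  by (auto simp: matrix_vector_mult_def cond_exp_nth[OF assms(1)] less_imp_le intro!: sum_nonneg)

lemma cond_exp_mono:
  assumes "partition_on UNIV R" "\<And>i. u $ i \<le> v $ i"
  shows "(cond_exp R *v u) $ i \<le> (cond_exp R *v v) $ i"
  using cond_exp_nonneg[OF assms(1), of "v - u" i] assms(2)
  by (simp add: matrix_vector_mult_diff_distrib)

lemma F_eq_block_outer: "F R = block_outer R 1 1"
  by (simp add: vec_eq_iff block_outer_nth)

text \<open>At \<open>i\<close>, both sides are the total of the entries of \<open>M\<close> in the
  block of \<open>i\<close>.\<close>

lemma F_mult_row_sums:
  assumes "partition_on UNIV R" "block_diagonal R M"
  shows "F R *v (M *v 1) = F R *v (1 v* M)"
proof -
  have "F R *v (M *v 1) = (block_outer R 1 1 ** M) *v 1"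
    by (simp add: F_eq_block_outer[symmetric] matrix_vector_mul_assoc)
  then show ?thesis
    by (simp add: block_outer_times_block_diagonal[OF assms] block_outer_mult_vec)
qed

lemma cond_exp_row_sums:
  assumes "partition_on UNIV R" "block_diagonal R M"
  shows "cond_exp R *v (M *v 1) = cond_exp R *v (1 v* M)"
  by (simp add: vec_eq_iff cond_exp_mult_vec_nth[OF assms(1)] F_mult_row_sums[OF assms])

text \<open>\<open>cond_exp Q\<close> is symmetric and fixes \<open>1\<close>, so its columns sum to
  one inside the blocks of \<open>R\<close>; hence multiplying by it does not change
  \<open>F R\<close>.\<close>

lemma cond_exp_tower:
  assumes "refines UNIV Q R"
  shows "cond_exp R *v (cond_exp Q *v v) = cond_exp R *v v"
proof -
  have Q: "partition_on UNIV Q" and R: "partition_on UNIV R"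
    using assms by (auto simp: refines_def)
  have "block_outer R 1 1 ** cond_exp Q = block_outer R 1 (1 v* cond_exp Q)"
    by (rule block_outer_times_block_diagonal[OF R block_diagonal_refines[OF assms block_diagonal_cond_exp[OF Q]]])
  also have "1 v* cond_exp Q = 1"
    by (metis transpose_cond_exp[OF Q] cond_exp_one[OF Q] vector_transpose_matrix)
  finally have "F R ** cond_exp Q = F R"
    by (simp add: F_eq_block_outer[symmetric])
  then have "F R *v (cond_exp Q *v v) = F R *v v"
    by (simp add: matrix_vector_mul_assoc)
  then show ?thesis
    by (simp add: vec_eq_iff cond_exp_mult_vec_nth[OF R] del: matrix_vector_mul_assoc)
qed

lemma cond_exp_tower_mult:
  assumes "refines UNIV Q R" "measurable_vec Q a"
  shows "cond_exp R *v (a * (cond_exp Q *v v)) = cond_exp R *v (a * v)"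
  using cond_exp_tower[OF assms(1), of "a * v"] assms
  by (simp add: cond_exp_measurable_mult refines_def)

subsection \<open>One step of the recursion\<close>

text \<open>The right-hand side of the recursion over the reals, with \<open>w\<close> standing for
  \<open>1 / (c + d)\<close> at the next index.\<close>

definition reciprocal_step ::
  "'n::finite set set \<Rightarrow> real^'n \<Rightarrow> real^'n \<Rightarrow> real^'n \<Rightarrow> real^'n \<Rightarrow> real^'n" where
  "reciprocal_step R g p q w =
     cond_exp R *v w - g * (cond_exp R *v (p * w)) * (cond_exp R *v (q * w))"

text \<open>Averaging \<open>le\<close> and pulling out the measurable factor gives
  \<open>g * y * e <= e\<close>, where \<open>e\<close> and \<open>y\<close> are the averages of
  \<open>q\<close> and \<open>q * w\<close>; then \<open>e\<close> is cancelled unless it is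
  zero.\<close>

lemma cond_exp_mult_le_one:
  assumes R: "partition_on UNIV R" and g: "measurable_vec R g"
    and q: "\<And>i. 0 \<le> q $ i" and w: "\<And>i. 0 \<le> w $ i"
    and le: "\<And>i. (g * (cond_exp R *v q) * (q * w)) $ i \<le> q $ i"
  shows "g $ i * (cond_exp R *v (q * w)) $ i \<le> 1"
proof -
  let ?e = "(cond_exp R *v q) $ i" and ?y = "(cond_exp R *v (q * w)) $ i"
  have "(cond_exp R *v (g * (cond_exp R *v q) * (q * w))) $ i \<le> ?e"
    by (rule cond_exp_mono[OF R le])
  then have *: "(g $ i * ?y) * ?e \<le> 1 * ?e"
    unfolding cond_exp_measurable_mult[OF R measurable_vec_mult[OF g measurable_cond_exp[OF R]]]
    by (simp add: mult_ac)
  have y: "0 \<le> ?y" and e: "0 \<le> ?e"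
    using cond_exp_nonneg[OF R] q w by simp_all
  show ?thesis
  proof (cases "?e = 0")
    case True
    \<comment> \<open>The sum of all entries of \<open>w\<close> bounds each of them, so
      \<open>q * w\<close> is dominated by a multiple of \<open>q\<close>, whose average is zero
      here.\<close>
    have "(q * w) $ j \<le> ((\<Sum>l\<in>UNIV. w $ l) *\<^sub>R q) $ j" for j
      using mult_left_mono[OF member_le_sum[of j UNIV "\<lambda>l. w $ l"] q[of j]] w by (simp add: mult.commute)
    then have "?y \<le> (cond_exp R *v ((\<Sum>l\<in>UNIV. w $ l) *\<^sub>R q)) $ i"
      by (rule cond_exp_mono[OF R])
    then have "?y = 0" using True y by (simp add: matrix_vector_mult_scaleR)
    then show ?thesis by simp
  next
    case False
    then show ?thesis using * e by (simp only: mult_le_cancel_right)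
  qed
qed

lemma measurable_partitionD:
  assumes "measurable_partition R p q"
  shows "p $ i = 0 \<and> q $ i = 1 \<or> p $ i = 1 \<and> q $ i = 0"
    and "p + q = 1" "p * q = 0" "measurable_vec R p" "measurable_vec R q"
proof -
  show pq: "p + q = 1" "p * q = 0" "measurable_vec R p" "measurable_vec R q"
    using assms by (auto simp: measurable_partition_def)
  have "(p + q) $ i = 1" using pq by simp
  moreover have "p $ i = 0 \<or> p $ i = 1"
    using assms by (auto simp: measurable_partition_def)
  ultimately show "p $ i = 0 \<and> q $ i = 1 \<or> p $ i = 1 \<and> q $ i = 0"
    by auto
qed

lemma measurable_partition_commute: "measurable_partition R p q \<Longrightarrow> measurable_partition R q p"
  by (auto simp: measurable_partition_def mult.commute add.commute)

lemma rho_commute: "rho R p q = rho R q p"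
  by (simp add: rho_def add.commute)

text \<open>Where \<open>q\<close> is 1, \<open>p\<close> is 0 and \<open>rho\<close> reduces to the
  average of \<open>q\<close>; where \<open>q\<close> is 0 the bound to be averaged is trivial.
  Swapping \<open>p\<close> and \<open>q\<close> gives the companion bound.\<close>

lemma rho_bound_imp_le_one:
  assumes R: "partition_on UNIV R" and g: "measurable_vec R g"
    and pq: "measurable_partition Q p q" and w: "\<And>i. 0 < w $ i"
    and rho: "\<And>i. (rho R p q * g * w) $ i \<le> 1"
  shows "g $ i * (cond_exp R *v (q * w)) $ i \<le> 1"
proof (rule cond_exp_mult_le_one[OF R g])
  fix j
  show "0 \<le> q $ j" using measurable_partitionD(1)[OF pq, of j] by auto
  show "0 \<le> w $ j" using w[of j] by simp
  show "(g * (cond_exp R *v q) * (q * w)) $ j \<le> q $ j"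
    using rho[of j] measurable_partitionD(1)[OF pq, of j] by (auto simp: rho_def mult_ac)
qed

text \<open>With \<open>x\<close> and \<open>y\<close> the averages of \<open>p * w\<close> and
  \<open>q * w\<close>, the step is \<open>x + y - g x y\<close>. Positivity follows from the form
  \<open>x (1 - g y) + y\<close> or its mirror image, since \<open>x + y > 0\<close>; the second
  bound is \<open>(1 - g x) (1 - g y) >= 0\<close>.\<close>

lemma reciprocal_step_bounds:
  assumes R: "partition_on UNIV R" and g: "measurable_vec R g" "\<And>i. 0 \<le> g $ i"
    and pq: "measurable_partition Q p q" and w: "\<And>i. 0 < w $ i"
    and rho: "\<And>i. (rho R p q * g * w) $ i \<le> 1"
  shows "0 < reciprocal_step R g p q w $ i"
    and "g $ i * reciprocal_step R g p q w $ i \<le> 1"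
proof -
  let ?x = "(cond_exp R *v (p * w)) $ i" and ?y = "(cond_exp R *v (q * w)) $ i"
  have y: "g $ i * ?y \<le> 1"
    by (rule rho_bound_imp_le_one[OF R g(1) pq w rho])
  have x: "g $ i * ?x \<le> 1"
    by (rule rho_bound_imp_le_one[OF R g(1) measurable_partition_commute[OF pq] w rho[unfolded rho_commute[of R p]]])
  have pos: "0 \<le> (p * w) $ j" "0 \<le> (q * w) $ j" for j
    using measurable_partitionD(1)[OF pq, of j] w[of j] by auto
  then have nonneg: "0 \<le> ?x" "0 \<le> ?y"
    by (intro cond_exp_nonneg[OF R]; simp)+
  have "cond_exp R *v w = cond_exp R *v (p * w) + cond_exp R *v (q * w)"
    using measurable_partitionD(2)[OF pq]
    by (metis matrix_vector_right_distrib distrib_right mult_1)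
  then have step: "reciprocal_step R g p q w $ i = ?x + ?y - g $ i * ?x * ?y"
    and sum: "(cond_exp R *v w) $ i = ?x + ?y"
    by (simp_all add: reciprocal_step_def)
  \<comment> \<open>The least entry of \<open>w\<close> is positive and bounds the average
    \<open>x + y\<close> from below.\<close>
  define m where "m = Min (range (\<lambda>j. w $ j))"
  have "m \<in> range (\<lambda>j. w $ j)" unfolding m_def by (rule Min_in) auto
  then have "0 < m" using w by auto
  moreover have "(m *\<^sub>R 1) $ j \<le> w $ j" for j by (simp add: m_def)
  then have "(cond_exp R *v (m *\<^sub>R 1)) $ i \<le> (cond_exp R *v w) $ i"
    by (rule cond_exp_mono[OF R])
  ultimately have "0 < ?x + ?y"
    using sum by (simp add: matrix_vector_mult_scaleR cond_exp_one[OF R])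
  then consider "0 < ?x" | "0 < ?y" using nonneg by linarith
  then have *: "0 < ?x + ?y - g $ i * ?x * ?y"
  proof cases
    case 1
    have "?x + ?y - g $ i * ?x * ?y = ?x * (1 - g $ i * ?y) + ?y" by (simp add: algebra_simps)
    moreover have "0 \<le> ?x * (1 - g $ i * ?y)" using nonneg y by simp
    moreover have "?y = 0 \<Longrightarrow> 0 < ?x + ?y - g $ i * ?x * ?y" using 1 by simp
    ultimately show ?thesis using nonneg by fastforce
  next
    case 2
    have "?x + ?y - g $ i * ?x * ?y = ?y * (1 - g $ i * ?x) + ?x" by (simp add: algebra_simps)
    moreover have "0 \<le> ?y * (1 - g $ i * ?x)" using nonneg x by simp
    moreover have "?x = 0 \<Longrightarrow> 0 < ?x + ?y - g $ i * ?x * ?y" using 2 by simp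
    ultimately show ?thesis using nonneg by fastforce
  qed
  show "0 < reciprocal_step R g p q w $ i" using * step by simp
  have "0 \<le> (1 - g $ i * ?x) * (1 - g $ i * ?y)" using x y by simp
  then show "g $ i * reciprocal_step R g p q w $ i \<le> 1"
    unfolding step by (simp add: algebra_simps)
qed

text \<open>The invariant of the induction: \<open>M\<close> is the inverse of \<open>V\<close>, and
  \<open>w\<close>, the average of its row sums over atoms, is the quantity that the recursion
  propagates. Entrywise nonnegativity of \<open>V\<close> is supplied separately at the end.\<close>

definition block_potential :: "'n::finite set set \<Rightarrow> real^'n^'n \<Rightarrow> real^'n \<Rightarrow> bool" where
  "block_potential R V w \<longleftrightarrow> block_diagonal R V \<and>
     (\<exists>M. V ** M = mat 1 \<and> block_diagonal R M \<and> (\<forall>i j. i \<noteq> j \<longrightarrow> M $ i $ j \<le> 0) \<and>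
          (\<forall>i. 0 \<le> (M *v 1) $ i) \<and> (\<forall>i. 0 \<le> (1 v* M) $ i) \<and> cond_exp R *v (M *v 1) = w)"

lemma block_potential_mat_one:
  assumes "partition_on UNIV R"
  shows "block_potential R (mat 1) 1"
proof -
  have "block_diagonal R (mat 1)"
    using F_refl[OF assms] by (auto simp: block_diagonal_def mat_def)
  then show ?thesis
    unfolding block_potential_def
    by (intro conjI exI[of _ "mat 1"]) (auto simp: mat_def[symmetric] cond_exp_one[OF assms], simp add: mat_def)
qed

lemma block_outer_mult_one: "block_outer R a b *v 1 = a * (F R *v b)"
  and one_mult_block_outer: "1 v* block_outer R a b = b * (F R *v a)"
  by (simp_all add: block_outer_mult_vec vec_mult_block_outer)

text \<open>The update multiplies the row sums by \<open>1 - p g y\<close> and the column sums by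
  \<open>1 - q g x\<close>, with \<open>x\<close> and \<open>y\<close> the averages of
  \<open>p * w\<close> and \<open>q * w\<close>; the last two hypotheses keep these factors
  nonnegative.\<close>

lemma block_potential_add_split:
  assumes QR: "refines UNIV Q R" and V: "block_potential Q V w"
    and G: "measurable_vec R G" "\<And>i. 0 \<le> G $ i" and g: "g = G * (F R *v 1)"
    and pq: "measurable_partition Q p q"
    and x: "\<And>i. g $ i * (cond_exp R *v (p * w)) $ i \<le> 1"
    and y: "\<And>i. g $ i * (cond_exp R *v (q * w)) $ i \<le> 1"
  shows "block_potential R (V + diag G ** diag p ** F R ** diag q) (reciprocal_step R g p q w)"
proof -
  have Q: "partition_on UNIV Q" and R: "partition_on UNIV R"
    using QR by (auto simp: refines_def)
  note p = measurable_partitionD(4)[OF pq] and q = measurable_partitionD(5)[OF pq]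
  obtain M where VQ: "block_diagonal Q V" and inv: "V ** M = mat 1" and MQ: "block_diagonal Q M"
    and off: "\<And>i j. i \<noteq> j \<Longrightarrow> M $ i $ j \<le> 0"
    and row: "\<And>i. 0 \<le> (M *v 1) $ i" and col: "\<And>i. 0 \<le> (1 v* M) $ i"
    and mass: "cond_exp Q *v (M *v 1) = w"
    using V unfolding block_potential_def by blast
  have VR: "block_diagonal R V" and MR: "block_diagonal R M"
    using block_diagonal_refines[OF QR] VQ MQ by auto
  define l m where "l = M *v 1" and "m = 1 v* M"
  \<comment> \<open>\<open>p\<close> and \<open>q\<close> are constant on the blocks of the finer
    partition \<open>Q\<close>, for which \<open>M\<close> is block diagonal.\<close>
  have Mp: "M *v p = p * l" and qM: "q v* M = q * m"
    using block_diagonal_mult_measurable[OF MQ p, of 1] block_diagonal_measurable_mult[OF MQ q, of 1]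
    by (simp_all add: l_def m_def)
  have El: "cond_exp R *v (p * l) = cond_exp R *v (p * w)"
    using cond_exp_tower_mult[OF QR p, of l] mass by (simp add: l_def)
  have Em: "cond_exp R *v (q * m) = cond_exp R *v (q * w)"
    using cond_exp_tower_mult[OF QR q, of m] mass cond_exp_row_sums[OF Q MQ] by (simp add: m_def)
  define N where "N = M - block_outer R (G * (p * l)) (q * m)"
  \<comment> \<open>The supports are disjoint, so the Sherman--Morrison denominator is 1 and the
    coefficient is \<open>G\<close> itself.\<close>
  have "q * (p * l) = 0"
    using measurable_partitionD(3)[OF pq] by (metis mult.assoc mult.commute mult_zero_left)
  then have VN: "(V + diag G ** diag p ** F R ** diag q) ** N = mat 1"
    using block_outer_update_inverse[OF R VR MR inv G(1), of G q p]
    by (simp add: N_def Mp qM diag_F_diag_eq_block_outer)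
  have N1: "N *v 1 = l - g * (p * l) * (cond_exp R *v (q * w))"
    unfolding N_def matrix_vector_mult_diff_rdistrib block_outer_mult_one F_mult_vec[OF R, of "q * m"]
      Em g l_def[symmetric]
    by (simp add: mult_ac)
  have "F R *v (G * (p * l)) = g * (cond_exp R *v (p * w))"
    unfolding block_diagonal_mult_measurable[OF block_diagonal_F G(1)] F_mult_vec[OF R, of "p * l"] El g
    by (simp add: mult_ac)
  then have N2: "1 v* N = m - q * m * (g * (cond_exp R *v (p * w)))"
    by (simp add: N_def vector_matrix_mult_diff_rdistrib one_mult_block_outer flip: m_def)
  have p01: "p $ i = 0 \<or> p $ i = 1" and q01: "q $ i = 0 \<or> q $ i = 1" for i
    using measurable_partitionD(1)[OF pq, of i] by auto
  have "N $ i $ j \<le> 0" if "i \<noteq> j" for i j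
  proof -
    have "0 \<le> G $ i * (p $ i * l $ i) * F R $ i $ j * (q $ j * m $ j)"
      using G(2)[of i] row[of i] col[of j] p01[of i] q01[of j] by (auto simp: l_def m_def)
    then show ?thesis using off[OF that] by (simp add: N_def block_outer_nth)
  qed
  moreover have "0 \<le> (N *v 1) $ i" for i
  proof -
    have "(N *v 1) $ i = l $ i * (1 - p $ i * (g $ i * (cond_exp R *v (q * w)) $ i))"
      by (simp add: N1 algebra_simps)
    then show ?thesis using row[of i] y[of i] p01[of i] by (auto simp: l_def)
  qed
  moreover have "0 \<le> (1 v* N) $ i" for i
  proof -
    have "(1 v* N) $ i = m $ i * (1 - q $ i * (g $ i * (cond_exp R *v (p * w)) $ i))"
      by (simp add: N2 algebra_simps)
    then show ?thesis using col[of i] x[of i] q01[of i] by (auto simp: m_def)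
  qed
  moreover have "cond_exp R *v (N *v 1) = reciprocal_step R g p q w"
  proof -
    have meas: "measurable_vec R (g * (cond_exp R *v (q * w)))"
      unfolding g by (intro measurable_vec_mult G(1) measurable_F_mult[OF R] measurable_cond_exp[OF R])
    have "N *v 1 = l - (g * (cond_exp R *v (q * w))) * (p * l)"
      by (simp add: N1 mult_ac)
    then have "cond_exp R *v (N *v 1) = cond_exp R *v l - (g * (cond_exp R *v (q * w))) * (cond_exp R *v (p * w))"
      by (simp only: matrix_vector_mult_diff_distrib cond_exp_measurable_mult[OF R meas] El)
    moreover have "cond_exp R *v l = cond_exp R *v w"
      using cond_exp_tower[OF QR, of l] mass by (simp add: l_def)
    ultimately show ?thesis by (simp add: reciprocal_step_def mult_ac)
  qed
  moreover have "block_diagonal R N" "block_diagonal R (V + diag G ** diag p ** F R ** diag q)"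
    by (simp_all add: N_def diag_F_diag_eq_block_outer block_diagonal_diff block_diagonal_add
        block_diagonal_block_outer MR VR)
  ultimately show ?thesis
    using VN unfolding block_potential_def by blast
qed

text \<open>Here \<open>h\<close> is the block total of the inverse, and the update scales row and
  column sums alike by \<open>r = 1 / (1 + C h)\<close>. Where \<open>v\<close> is positive, the
  reciprocal of the average grows by \<open>c = C * (F R *v 1)\<close>.\<close>

lemma block_potential_add_F:
  assumes R: "partition_on UNIV R" and V: "block_potential R V v"
    and C: "measurable_vec R C" "\<And>i. 0 \<le> C $ i"
  shows "block_potential R (V + diag C ** F R) (\<chi> i. v $ i / (1 + (C * (F R *v 1)) $ i * v $ i))"
proof -
  obtain M where VR: "block_diagonal R V" and inv: "V ** M = mat 1" and MR: "block_diagonal R M"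
    and off: "\<And>i j. i \<noteq> j \<Longrightarrow> M $ i $ j \<le> 0"
    and row: "\<And>i. 0 \<le> (M *v 1) $ i" and col: "\<And>i. 0 \<le> (1 v* M) $ i"
    and mass: "cond_exp R *v (M *v 1) = v"
    using V unfolding block_potential_def by blast
  define l m where "l = M *v 1" and "m = 1 v* M"
  define h where "h = F R *v l"
  define r where "r = (\<chi> i. 1 / (1 + C $ i * h $ i))"
  have h: "h = (F R *v 1) * v" and hm: "F R *v m = h"
    using F_mult_vec[OF R, of l] mass F_mult_row_sums[OF R MR] by (simp_all add: h_def l_def m_def)
  have v: "measurable_vec R v" "\<And>i. 0 \<le> v $ i"
    using mass measurable_cond_exp[OF R] cond_exp_nonneg[OF R row] by metis+
  have h0: "0 \<le> h $ i" for i
    using F_mult_one_pos[OF R, of i] v(2) by (simp add: h)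
  have hR: "measurable_vec R h"
    unfolding h_def by (rule measurable_F_mult[OF R])
  have r: "measurable_vec R r"
    using C(1) hR by (simp add: measurable_vec_iff_F r_def)
  have pos: "0 < 1 + C $ i * h $ i" for i
    using C(2)[of i] h0[of i] by (simp add: add_pos_nonneg)
  then have r0: "0 < r $ i" for i by (simp add: r_def)
  \<comment> \<open>This identity serves twice: it makes \<open>C * r\<close> the Sherman--Morrison
    coefficient and \<open>r\<close> the scaling factor of the row and column sums.\<close>
  have rr: "r = 1 - C * r * h"
  proof -
    have "r $ i = 1 - C $ i * r $ i * h $ i" for i
      using pos[of i] by (simp add: r_def divide_simps)
    then show ?thesis by (simp add: vec_eq_iff)
  qed
  define N where "N = M - block_outer R (C * r * l) m"
  have VN: "(V + diag C ** F R) ** N = mat 1"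
  proof -
    have "C * r + C * r * C * h = C * (r + C * r * h)" by (simp add: algebra_simps)
    also have "\<dots> = C" using rr by (metis add.commute diff_add_cancel mult_1_right)
    finally have "C * r + C * r * C * (F R *v (1 * (M *v 1))) = C" by (simp add: h_def l_def)
    from block_outer_update_inverse[OF R VR MR inv measurable_vec_mult[OF C(1) r] this]
    show ?thesis by (simp add: N_def diag_F_eq_block_outer l_def m_def)
  qed
  have "N *v 1 = l - C * r * l * h"
    by (simp add: N_def matrix_vector_mult_diff_rdistrib block_outer_mult_one hm flip: l_def)
  also have "\<dots> = (1 - C * r * h) * l" by (simp add: algebra_simps)
  finally have N1: "N *v 1 = r * l" by (simp only: rr[symmetric])
  have "1 v* N = m - C * r * h * m"
    unfolding N_def vector_matrix_mult_diff_rdistrib one_mult_block_outer h_def m_def[symmetric]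
      block_diagonal_mult_measurable[OF block_diagonal_F measurable_vec_mult[OF C(1) r]]
    by (simp add: mult_ac)
  also have "\<dots> = (1 - C * r * h) * m" by (simp add: algebra_simps)
  finally have N2: "1 v* N = r * m" by (simp only: rr[symmetric])
  have "N $ i $ j \<le> 0" if "i \<noteq> j" for i j
  proof -
    have "0 \<le> C $ i * r $ i * l $ i * F R $ i $ j * m $ j"
      using C(2)[of i] r0[of i] row[of i] col[of j] by (simp add: l_def m_def)
    then show ?thesis using off[OF that] by (simp add: N_def block_outer_nth)
  qed
  moreover have "0 \<le> (N *v 1) $ i" "0 \<le> (1 v* N) $ i" for i
    using r0[of i] row[of i] col[of i] by (simp_all add: N1 N2 l_def m_def)
  moreover have "cond_exp R *v (N *v 1) = (\<chi> i. v $ i / (1 + (C * (F R *v 1)) $ i * v $ i))"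
    using cond_exp_measurable_mult[OF R r, of l] mass
    by (simp add: N1 l_def[symmetric]) (simp add: vec_eq_iff r_def h mult_ac)
  moreover have "block_diagonal R N" "block_diagonal R (V + diag C ** F R)"
    by (simp_all add: N_def diag_F_eq_block_outer block_diagonal_diff block_diagonal_add
        block_diagonal_block_outer MR VR)
  ultimately show ?thesis
    using VN unfolding block_potential_def by blast
qed

lemma block_potential_imp_bi_potential:
  assumes "block_potential R V w" "\<And>i j. 0 \<le> V $ i $ j"
  shows "bi_potential V"
proof -
  obtain M where "V ** M = mat 1" "\<And>i j. i \<noteq> j \<Longrightarrow> M $ i $ j \<le> 0"
    "\<And>i. 0 \<le> (M *v 1) $ i" "\<And>i. 0 \<le> (1 v* M) $ i"
    using assms(1) unfolding block_potential_def by blast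
  then show ?thesis
    by (intro bi_potentialI[OF assms(2), of M])
      (simp_all add: matrix_vector_mult_def vector_matrix_mult_def)
qed

subsection \<open>The backward recursion\<close>

definition recip :: "real^'n \<Rightarrow> real^'n" where
  "recip v = (\<chi> i. 1 / v $ i)"

lemma recip_nth [simp]: "recip v $ i = 1 / v $ i"
  by (simp add: recip_def)

lemma ereal_vec_nth [simp]: "ereal_vec v $ i = ereal (v $ i)"
  by (simp add: ereal_vec_def)

lemma ereal_vec_one: "1 = ereal_vec 1"
  by (simp add: vec_eq_iff one_ereal_def)

lemma ereal_vec_add: "ereal_vec u + ereal_vec v = ereal_vec (u + v)"
  and ereal_vec_diff: "ereal_vec u - ereal_vec v = ereal_vec (u - v)"
  and ereal_vec_mult: "ereal_vec u * ereal_vec v = ereal_vec (u * v)"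
  by (simp_all add: vec_eq_iff)

lemma ereal_vec_le_iff: "ereal_vec u \<le> ereal_vec v \<longleftrightarrow> (\<forall>i. u $ i \<le> v $ i)"
  by (simp add: less_eq_vec_def)

lemma cond_exp_ereal_vec: "cond_exp_ereal R (ereal_vec v) = ereal_vec (cond_exp R *v v)"
  by (simp add: vec_eq_iff cond_exp_ereal_def matrix_vector_mult_def)

lemma quot_ereal_vec:
  assumes "\<And>i. v $ i \<noteq> 0"
  shows "quot (ereal_vec u) (ereal_vec v) = ereal_vec (u * recip v)"
  using assms by (simp add: vec_eq_iff quot_def divide_inverse)

text \<open>A positive real reciprocal excludes the values 0 and infinity of \<open>e\<close>, so
  nonnegative solutions of the recursion are finite.\<close>

lemma quot_one_eq_ereal_vec_iff:
  assumes "0 \<le> e" "\<And>i. 0 < r $ i"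
  shows "quot 1 e = ereal_vec r \<longleftrightarrow> e = ereal_vec (recip r)"
proof -
  have "1 / e $ i = ereal (r $ i) \<longleftrightarrow> e $ i = ereal (1 / r $ i)" for i
  proof -
    have "0 \<le> e $ i" using assms(1) by (simp add: less_eq_vec_def)
    then show ?thesis
      using assms(2)[of i] by (cases "e $ i") (auto simp: divide_ereal_def one_ereal_def field_simps)
  qed
  then show ?thesis by (simp add: vec_eq_iff quot_def)
qed

text \<open>The data are locale parameters so that the results can be instantiated a second time
  with \<open>C\<close> and \<open>G\<close> multiplied by \<open>t\<close>.\<close>

locale filtered_matrix =
  fixes k :: nat and R :: "nat \<Rightarrow> 'n::finite set set" and C G p q c g :: "nat \<Rightarrow> real^'n"
  assumes partition: "\<And>s. s \<le> k \<Longrightarrow> partition_on UNIV (R s)"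
    and refines: "\<And>s. s < k \<Longrightarrow> refines UNIV (R (Suc s)) (R s)"
    and C: "\<And>s i. s \<le> k \<Longrightarrow> 0 \<le> C s $ i" "\<And>s. s \<le> k \<Longrightarrow> measurable_vec (R s) (C s)"
    and G: "\<And>s i. s \<le> k \<Longrightarrow> 0 \<le> G s $ i" "\<And>s. s \<le> k \<Longrightarrow> measurable_vec (R s) (G s)"
    and G_last: "G k = 0"
    and pq: "\<And>s. s < k \<Longrightarrow> measurable_partition (R (Suc s)) (p s) (q s)"
    and c: "\<And>s. c s = C s * (F (R s) *v 1)" and g: "\<And>s. g s = G s * (F (R s) *v 1)"
    and rho_le: "\<And>s i. s < k \<Longrightarrow>
      (rho (R s) (p s) (q s) * g s) $ i \<le> (c (Suc s) + g (Suc s)) $ i"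
begin

abbreviation step :: "nat \<Rightarrow> real^'n \<Rightarrow> real^'n" where
  "step s \<equiv> reciprocal_step (R s) (g s) (p s) (q s)"

text \<open>The recursion starts at \<open>k\<close> and runs down, so the argument is the distance
  from \<open>k\<close>.\<close>

primrec solution_rev :: "nat \<Rightarrow> real^'n" where
  "solution_rev 0 = 1"
| "solution_rev (Suc m) = recip (step (k - Suc m) (recip (c (k - m) + solution_rev m)))"

definition solution :: "nat \<Rightarrow> real^'n" where
  "solution s = solution_rev (k - s)"

lemma solution_last: "solution k = 1"
  by (simp add: solution_def)

lemma solution_step:
  assumes "s < k"
  shows "solution s = recip (step s (recip (c (Suc s) + solution (Suc s))))"
proof -
  have "k - s = Suc (k - Suc s)" "k - (k - Suc s) = Suc s" "k - Suc (k - Suc s) = s"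
    using assms by auto
  then show ?thesis by (simp only: solution_def solution_rev.simps)
qed

lemma c_nonneg: "s \<le> k \<Longrightarrow> 0 \<le> c s $ i"
  using F_mult_one_pos[OF partition, of s i] C(1)[of s i] by (simp add: c)

lemma g_nonneg: "s \<le> k \<Longrightarrow> 0 \<le> g s $ i"
  using F_mult_one_pos[OF partition, of s i] G(1)[of s i] by (simp add: g)

lemma g_measurable: "s \<le> k \<Longrightarrow> measurable_vec (R s) (g s)"
  unfolding g by (intro measurable_vec_mult G measurable_F_mult partition)

text \<open>The bound \<open>g <= d\<close> at the next index upgrades the hypothesis from
  \<open>c + g\<close> to \<open>c + d\<close>.\<close>

lemma rho_recip_le_one:
  assumes "s < k" "\<And>i. 0 < d $ i" "\<And>i. g (Suc s) $ i \<le> d $ i"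
  shows "(rho (R s) (p s) (q s) * g s * recip (c (Suc s) + d)) $ i \<le> 1"
proof -
  have "0 < c (Suc s) $ i + d $ i"
    using c_nonneg[of "Suc s" i] assms(1) assms(2)[of i] by simp
  moreover have "(rho (R s) (p s) (q s) * g s) $ i \<le> c (Suc s) $ i + d $ i"
    using rho_le[OF assms(1), of i] assms(3)[of i] by simp
  ultimately show ?thesis by simp
qed

text \<open>
  With \<open>x\<close> and \<open>y\<close> the averages of \<open>p\<^sub>s\<close> and \<open>q\<^sub>s\<close> in the recursion,
  \<open>\<gamma>\<^sub>s / d\<^sub>s = 1 - (1 - \<gamma>\<^sub>s x) (1 - \<gamma>\<^sub>s y)\<close>, so that the bound passes from \<open>s + 1\<close> to \<open>s\<close>.
\<close>

lemma solution_bounds: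
  assumes "s \<le> k"
  shows "\<forall>i. 0 < solution s $ i \<and> g s $ i \<le> solution s $ i"
  using assms
proof (induction s rule: inc_induct)
  case base
  have "g k = 0" unfolding g G_last by simp
  then show ?case by (simp add: solution_last)
next
  case (step s)
  let ?w = "recip (c (Suc s) + solution (Suc s))"
  have s: "s \<le> k" "Suc s \<le> k" using step by auto
  have w: "0 < ?w $ i" for i
    using step.IH c_nonneg[OF s(2), of i] by (simp add: add_nonneg_pos)
  have rho: "(rho (R s) (p s) (q s) * g s * ?w) $ i \<le> 1" for i
    using step by (intro rho_recip_le_one) auto
  note bounds = reciprocal_step_bounds[OF partition[OF s(1)] g_measurable[OF s(1)] g_nonneg[OF s(1)]
      pq[OF step(2)] w rho]
  show ?case
  proof
    fix i
    have "0 < step s ?w $ i" "g s $ i * step s ?w $ i \<le> 1"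
      by (rule bounds)+
    then show "0 < solution s $ i \<and> g s $ i \<le> solution s $ i"
      by (simp add: solution_step[OF step(2)] field_simps)
  qed
qed

lemma solution_pos: "s \<le> k \<Longrightarrow> 0 < solution s $ i"
  using solution_bounds by blast

lemma recip_solution_pos: "s < k \<Longrightarrow> 0 < recip (c (Suc s) + solution (Suc s)) $ i"
  using c_nonneg[of "Suc s" i] solution_pos[of "Suc s" i] by (simp add: add_nonneg_pos)

lemma rho_recip_solution_le_one:
  "s < k \<Longrightarrow> (rho (R s) (p s) (q s) * g s * recip (c (Suc s) + solution (Suc s))) $ i \<le> 1"
  using solution_bounds[of "Suc s"] by (intro rho_recip_le_one) auto

lemma step_solution_pos:
  assumes "s < k"
  shows "0 < step s (recip (c (Suc s) + solution (Suc s))) $ i"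
  using assms
  by (intro reciprocal_step_bounds(1)[OF partition g_measurable g_nonneg pq recip_solution_pos
        rho_recip_solution_le_one]) auto

lemma rho_le_solution:
  assumes "s < k"
  shows "(rho (R s) (p s) (q s) * g s) $ i \<le> (c (Suc s) + solution (Suc s)) $ i"
  using rho_le[OF assms, of i] solution_bounds[of "Suc s"] assms
  by (auto intro: order_trans simp: Suc_le_eq)

lemma ereal_step:
  assumes "s < k"
  shows "cond_exp_ereal (R s) (quot 1 (ereal_vec (c (Suc s)) + ereal_vec (solution (Suc s))))
          - ereal_vec (g s)
            * cond_exp_ereal (R s) (quot (ereal_vec (p s)) (ereal_vec (c (Suc s)) + ereal_vec (solution (Suc s))))
            * cond_exp_ereal (R s) (quot (ereal_vec (q s)) (ereal_vec (c (Suc s)) + ereal_vec (solution (Suc s))))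
        = ereal_vec (step s (recip (c (Suc s) + solution (Suc s))))"
proof -
  have "(c (Suc s) + solution (Suc s)) $ i \<noteq> 0" for i
    using c_nonneg[of "Suc s" i] solution_pos[of "Suc s" i] assms by simp
  then show ?thesis
    by (simp add: ereal_vec_one ereal_vec_add quot_ereal_vec cond_exp_ereal_vec ereal_vec_mult
        ereal_vec_diff reciprocal_step_def)
qed

text \<open>Going down from \<open>k\<close>, the right-hand side is a positive real vector and
  determines \<open>d s\<close>. Statements about all nonnegative solutions thus reduce to
  \<open>solution\<close>.\<close>

lemma backward_recursion_iff:
  assumes "\<forall>s\<le>k. 0 \<le> d s"
  shows "backward_recursion k R c g p q d \<longleftrightarrow> (\<forall>s\<le>k. d s = ereal_vec (solution s))"
proof
  assume d: "backward_recursion k R c g p q d"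
  show "\<forall>s\<le>k. d s = ereal_vec (solution s)"
  proof (intro allI impI)
    fix s assume "s \<le> k"
    then show "d s = ereal_vec (solution s)"
    proof (induction s rule: inc_induct)
      case base
      then show ?case using d by (simp add: backward_recursion_def solution_last ereal_vec_one)
    next
      case (step s)
      have "quot 1 (d s) = ereal_vec (step s (recip (c (Suc s) + solution (Suc s))))"
        using d step ereal_step[of s] by (simp add: backward_recursion_def)
      then show ?case
        using assms step step_solution_pos[of s]
        by (simp add: quot_one_eq_ereal_vec_iff solution_step)
    qed
  qed
next
  assume d: "\<forall>s\<le>k. d s = ereal_vec (solution s)"
  have "quot 1 (d s) = ereal_vec (step s (recip (c (Suc s) + solution (Suc s))))" if "s < k" for s
  proof -
    have "0 \<le> d s" "d s = ereal_vec (recip (step s (recip (c (Suc s) + solution (Suc s)))))"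
      using that assms d solution_step[OF that] less_imp_le[OF that] by metis+
    then show ?thesis
      using quot_one_eq_ereal_vec_iff step_solution_pos[OF that] by blast
  qed
  then show "backward_recursion k R c g p q d"
    using d ereal_step by (simp add: backward_recursion_def solution_last ereal_vec_one)
qed

lemma ex_backward_recursion: "\<exists>d. backward_recursion k R c g p q d \<and> (\<forall>s\<le>k. 0 \<le> d s)"
proof -
  have "\<forall>s\<le>k. 0 \<le> ereal_vec (solution s)"
    using solution_pos by (simp add: less_eq_vec_def less_imp_le)
  then show ?thesis
    using backward_recursion_iff[of "\<lambda>s. ereal_vec (solution s)"] by auto
qed

section \<open>Tails of the sum and bi-potentials\<close>

definition level :: "nat \<Rightarrow> real^'n^'n" where
  "level s = diag (C s) ** F (R s) + diag (G s) ** diag (p s) ** F (R s) ** diag (q s)"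

lemma level_nonneg:
  assumes "s \<le> k"
  shows "0 \<le> level s $ i $ j"
\<comment> \<open>Nothing is known about \<open>p k\<close> and \<open>q k\<close>; at
  \<open>s = k\<close> the second summand vanishes because \<open>G k = 0\<close>.\<close>
proof (cases "s < k")
  case True
  then have "0 \<le> p s $ i" "0 \<le> q s $ j"
    using measurable_partitionD(1)[OF pq[OF True], of i] measurable_partitionD(1)[OF pq[OF True], of j] by auto
  then show ?thesis using C(1)[OF assms, of i] G(1)[OF assms, of i]
    by (simp add: level_def diag_F_diag_eq_block_outer block_outer_nth diag_mult_nth)
next
  case False
  then have "s = k" using assms by simp
  then show ?thesis using C(1)[OF assms, of i] G_last
    by (simp add: level_def diag_F_diag_eq_block_outer block_outer_nth diag_mult_nth)
qed

lemma block_potential_tail: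
  assumes "s \<le> k"
  shows "block_potential (R s) (mat 1 + (\<Sum>r=s..k. level r)) (recip (c s + solution s))"
  using assms
proof (induction s rule: inc_induct)
  case base
  \<comment> \<open>The identity matrix has row sums 1, matching \<open>solution k = 1\<close>; only
    the \<open>C\<close> term is added at this level.\<close>
  have "recip (c k + solution k) = (\<chi> i. 1 $ i / (1 + (C k * (F (R k) *v 1)) $ i * 1 $ i))"
    by (simp add: vec_eq_iff solution_last c add.commute)
  moreover have "level k = diag (C k) ** F (R k)"
    using G_last by (simp add: level_def diag_F_diag_eq_block_outer) (simp add: vec_eq_iff block_outer_nth)
  ultimately show ?case
    using block_potential_add_F[OF partition block_potential_mat_one[OF partition] C(2) C(1), of k] by simp
next
  case (step s)
  let ?w = "recip (c (Suc s) + solution (Suc s))"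
  let ?tail = "mat 1 + (\<Sum>r=Suc s..k. level r)"
  \<comment> \<open>The \<open>p\<close>, \<open>q\<close> term is added first, while the matrix is
    still block diagonal for \<open>R (Suc s)\<close>, where \<open>p\<close> and \<open>q\<close>
    are measurable.\<close>
  let ?W = "?tail + diag (G s) ** diag (p s) ** F (R s) ** diag (q s)"
  have s: "s < k" "s \<le> k" using step by auto
  note bound = rho_bound_imp_le_one[OF partition[OF s(2)] g_measurable[OF s(2)] _ recip_solution_pos[OF s(1)]]
  have "block_potential (R s) ?W (step s ?w)"
    using bound[OF pq[OF s(1)]] bound[OF measurable_partition_commute[OF pq[OF s(1)]]]
      rho_recip_solution_le_one[OF s(1)]
    by (intro block_potential_add_split[OF refines[OF s(1)] step.IH G(2)[OF s(2)] G(1)[OF s(2)] g pq[OF s(1)]])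
      (simp_all add: rho_commute[of _ "q s"])
  from block_potential_add_F[OF partition[OF s(2)] this C(2)[OF s(2)] C(1)[OF s(2)]]
  have "block_potential (R s) (?W + diag (C s) ** F (R s))
      (\<chi> i. step s ?w $ i / (1 + c s $ i * step s ?w $ i))"
    by (simp only: c)
  moreover have "(\<chi> i. step s ?w $ i / (1 + c s $ i * step s ?w $ i)) = recip (c s + solution s)"
  proof -
    have "step s ?w $ i / (1 + c s $ i * step s ?w $ i) = 1 / (c s $ i + 1 / step s ?w $ i)" for i
      using step_solution_pos[OF s(1), of i] by (simp add: divide_simps mult.commute)
    then show ?thesis by (simp only: vec_eq_iff vec_lambda_beta recip_nth vector_add_component
          solution_step[OF s(1)] simp_thms)
  qed
  moreover have "?W + diag (C s) ** F (R s) = mat 1 + (\<Sum>r=s..k. level r)"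
    using s by (simp add: sum.atLeast_Suc_atMost level_def)
  ultimately show ?case by simp
qed

lemma bi_potential_mat_one_add: "bi_potential (mat 1 + (\<Sum>s\<le>k. level s))"
proof (rule block_potential_imp_bi_potential)
  show "block_potential (R 0) (mat 1 + (\<Sum>s\<le>k. level s)) (recip (c 0 + solution 0))"
    using block_potential_tail[of 0] by (simp add: atLeast0AtMost)
  show "0 \<le> (mat 1 + (\<Sum>s\<le>k. level s)) $ i $ j" for i j
    by (auto simp: mat_def intro!: add_nonneg_nonneg sum_nonneg level_nonneg)
qed

text \<open>\<open>rho\<close> depends only on \<open>R\<close>, \<open>p\<close> and
  \<open>q\<close>, so both sides of the hypothesis are linear in \<open>t\<close>.\<close>

lemma scaled: "0 \<le> t \<Longrightarrow> filtered_matrix k R (\<lambda>s. t *\<^sub>R C s) (\<lambda>s. t *\<^sub>R G s) p q (\<lambda>s. t *\<^sub>R c s) (\<lambda>s. t *\<^sub>R g s)"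
  using mult_left_mono[OF rho_le, of _ t]
  by unfold_locales
    (auto simp: partition refines C G G_last pq measurable_vec_scaleR algebra_simps c g)

lemma level_scaled: "0 \<le> t \<Longrightarrow> filtered_matrix.level R (\<lambda>s. t *\<^sub>R C s) (\<lambda>s. t *\<^sub>R G s) p q s = t *\<^sub>R level s"
  by (simp add: filtered_matrix.level_def[OF scaled] level_def diag_F_diag_eq_block_outer
      diag_F_eq_block_outer vec_eq_iff block_outer_nth algebra_simps)

lemma bi_potential_mat_one_add_scaled:
  assumes "0 \<le> t"
  shows "bi_potential (mat 1 + t *\<^sub>R (\<Sum>s\<le>k. level s))"
  using filtered_matrix.bi_potential_mat_one_add[OF scaled[OF assms]]
  by (simp add: level_scaled[OF assms] scaleR_sum_right)

lemma bi_potential_if_invertible: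
  assumes "invertible (\<Sum>s\<le>k. level s)"
  shows "bi_potential (\<Sum>s\<le>k. level s)"
proof (rule bi_potential_limit[OF _ assms])
  let ?U = "\<Sum>s\<le>k. level s"
  \<comment> \<open>This equals \<open>U + I / (n + 1)\<close>; the shift by one keeps the scalar
    positive at \<open>n = 0\<close>.\<close>
  let ?f = "\<lambda>n. inverse (real (Suc n)) *\<^sub>R (mat 1 + real (Suc n) *\<^sub>R ?U)"
  show "bi_potential (?f n)" for n
    by (intro bi_potential_scaleR bi_potential_mat_one_add_scaled) auto
  have "(\<lambda>n. inverse (real (Suc n)) *\<^sub>R mat 1 + ?U) \<longlonglongrightarrow> 0 *\<^sub>R mat 1 + ?U"
    by (intro tendsto_intros LIMSEQ_inverse_real_of_nat)
  then show "?f \<longlonglongrightarrow> ?U"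
    by (simp add: scaleR_add_right)
qed

end

theorem corollary5p1:
  fixes U :: "real^'n^'n"
    and R :: "nat \<Rightarrow> 'n set set"
    and k :: nat
    and C \<Gamma> p q c \<gamma> :: "nat \<Rightarrow> real^'n"
  assumes "filtration k R"
    and "R 0 = trivial_partition"
    and "R k = singleton_partition"
    and "\<And>s. s \<le> k \<Longrightarrow> 0 \<le> C s \<and> measurable_vec (R s) (C s)"
    and "\<And>s. s \<le> k \<Longrightarrow> 0 \<le> \<Gamma> s \<and> measurable_vec (R s) (\<Gamma> s)"
    and "\<Gamma> k = 0"
    and "\<And>s. s < k \<Longrightarrow> measurable_partition (R (Suc s)) (p s) (q s)"
    and "U = (\<Sum>s\<le>k. diag (C s) ** F (R s) + diag (\<Gamma> s) ** diag (p s) ** F (R s) ** diag (q s))"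
    and "\<And>s. c s = C s * (F (R s) *v 1)"
    and "\<And>s. \<gamma> s = \<Gamma> s * (F (R s) *v 1)"
    and "\<And>s. s < k \<Longrightarrow> rho (R s) (p s) (q s) * \<gamma> s \<le> c (Suc s) + \<gamma> (Suc s)"
  shows "(\<exists>d. backward_recursion k R c \<gamma> p q d \<and> (\<forall>s\<le>k. 0 \<le> d s)) \<and>
         (\<forall>d. backward_recursion k R c \<gamma> p q d \<and> (\<forall>s\<le>k. 0 \<le> d s) \<longrightarrow>
            (\<forall>s<k. ereal_vec (rho (R s) (p s) (q s) * \<gamma> s) \<le> ereal_vec (c (Suc s)) + d (Suc s))) \<and>
         (\<forall>t::real. 0 \<le> t \<longrightarrow> bi_potential (mat 1 + t *\<^sub>R U)) \<and>
         (invertible U \<longrightarrow> bi_potential U)"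
proof -
  interpret filtered_matrix k R C \<Gamma> p q c \<gamma>
    using assms(1,4-7,9-11)
    by unfold_locales (simp_all add: filtration_def coarser_def less_eq_vec_def)
  have U: "U = (\<Sum>s\<le>k. level s)"
    using assms(8) by (simp add: level_def)
  \<comment> \<open>By uniqueness \<open>d\<close> agrees with \<open>solution\<close> up to index
    \<open>k\<close>, so the bound is one between real vectors.\<close>
  have "ereal_vec (rho (R s) (p s) (q s) * \<gamma> s) \<le> ereal_vec (c (Suc s)) + d (Suc s)"
    if "backward_recursion k R c \<gamma> p q d" "\<forall>s\<le>k. 0 \<le> d s" "s < k" for d s
    using that rho_le_solution[OF that(3)]
    by (simp add: backward_recursion_iff Suc_le_eq ereal_vec_add ereal_vec_le_iff)
  then show ?thesis
    using ex_backward_recursion bi_potential_mat_one_add_scaled bi_potential_if_invertible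
    unfolding U by blast
qed

end
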